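(* Let $C\subset \mathbb{P}^{n+1}$ be a rational normal curve, let $O\in\mathbb{P}^{n+1}\setminus C$, and let $X:=\ell_O(C)\subset\mathbb{P}^n$ be the linear projection of $C$ from $O$. For $P\in\mathbb{P}^n$ let $L_P\subset\mathbb{P}^{n+1}$ be the line through $O$ corresponding to $P$. If $P\in\mathbb{P}^n$ is a point such that $R_X(P)\le R_C(O)-1$, then $$R_X(P)=\min_{A\in L_P\setminus\{O\}} R_C(A).$$
   Context: All projective spaces are over an algebraically closed field of characteristic $0$. $\ell_O:\mathbb{P}^{n+1}\setminus\{O\}\to\mathbb{P}^n$ is the linear projection from the point $O$. For $P\in\mathbb{P}^n$, $L_P:=\{O\}\cup\ell_O^{-1}(P)$, a line through $O$; identifying $\mathbb{P}^n$ with a hyperplane of $\mathbb{P}^{n+1}$ not containing $O$, $L_P=\langle O,P\rangle$. For an integral non-degenerate projective variety $Y\subset\mathbb{P}^r$ and $Q\in\mathbb{P}^r$, the $Y$-rank $R_Y(Q)$ is the minimum number of distinct points of $Y$ whose linear span contains $Q$. *)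

theory Defs
  imports "HOL-Analysis.Analysis"
begin

text \<open>
  The projective space $\mathbf{P}(K^m)$, of dimension \<open>CARD('m) - 1\<close>: its points are the
  one-dimensional linear subspaces of \<open>'k ^ 'm\<close>.
\<close>

typedef (overloaded) ('k::field, 'm::finite) proj =
  "{L :: ('k ^ 'm) set. vec.subspace L \<and> vec.dim L = 1}"
  morphisms line_of Abs_proj
proof -
  have "vec.dim (vec.span {axis undefined 1 :: 'k ^ 'm}) = 1"
    by (simp add: vec.dim_span vec.dim_eq_card_independent vec.independent_insert axis_eq_0_iff)
  then show ?thesis
    using vec.subspace_span by blast
qed

definition proj_point :: "'k::field ^ 'm::finite \<Rightarrow> ('k, 'm) proj" where
  "proj_point v = Abs_proj (vec.span {v})"

lemma line_of_proj_point:
  fixes v :: "'k::field ^ 'm::finite"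
  assumes "v \<noteq> 0"
  shows "line_of (proj_point v) = vec.span {v}"
proof -
  have "vec.dim (vec.span {v}) = 1"
    using assms by (simp add: vec.dim_span vec.dim_eq_card_independent vec.independent_insert)
  then show ?thesis
    by (simp add: proj_point_def Abs_proj_inverse vec.subspace_span)
qed

definition proj_span :: "('k::field, 'm::finite) proj set \<Rightarrow> ('k, 'm) proj set" where
  "proj_span S = {P. line_of P \<subseteq> vec.span (\<Union>A\<in>S. line_of A)}"

text \<open>
  The \<open>Y\<close>-rank. It is meaningful when \<open>Y\<close> is non-degenerate, so that the set of admissible
  cardinalities is non-empty.
\<close>

definition proj_rank :: "('k::field, 'm::finite) proj set \<Rightarrow> ('k, 'm) proj \<Rightarrow> nat" where
  "proj_rank Y Q = (LEAST k. \<exists>S\<subseteq>Y. finite S \<and> card S = k \<and> Q \<in> proj_span S)"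

text \<open>
  With $d$ = \<open>CARD('m) - 1\<close> and the coordinates numbered $0, \dots, d$ by \<open>idx\<close>, the vector
  $(s^{d-i} t^i)_{0 \le i \le d}$ for $(s, t)$ = \<open>(x $ 1, x $ 2)\<close>. A rational normal curve is a
  curve projectively equivalent to the resulting image of $\mathbf{P}^1$; different numberings
  give projectively equivalent images.
\<close>

definition veronese_vec :: "('m \<Rightarrow> nat) \<Rightarrow> 'k::field ^ 2 \<Rightarrow> 'k ^ 'm::finite" where
  "veronese_vec idx x = (\<chi> i. (x $ 1) ^ (CARD('m) - 1 - idx i) * (x $ 2) ^ idx i)"

definition rational_normal_curve :: "('k::field, 'm::finite) proj set \<Rightarrow> bool" where
  "rational_normal_curve C \<longleftrightarrow>
     (\<exists>(idx :: 'm \<Rightarrow> nat) (M :: 'k ^ 'm ^ 'm).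
        bij_betw idx UNIV {..<CARD('m)} \<and> invertible M \<and>
        C = {proj_point (M *v veronese_vec idx x) | x. x \<noteq> 0})"

text \<open>
  Linear projection from \<open>p\<close>: the map induced by a surjective linear map whose kernel is the line
  \<open>p\<close>. The value of \<open>ell\<close> at \<open>p\<close> itself is irrelevant. For a hyperplane not containing \<open>p\<close>, taking
  \<open>f\<close> to be the projection along \<open>p\<close> followed by a choice of coordinates gives the map
  \<open>A \<mapsto> \<langle>p, A\<rangle> \<inter> H\<close>.
\<close>

definition linear_projection_from ::
    "('k::field, 'm::finite) proj \<Rightarrow> (('k, 'm) proj \<Rightarrow> ('k, 'l::finite) proj) \<Rightarrow> bool" where
  "linear_projection_from p ell \<longleftrightarrow>
     (\<exists>f :: 'k ^ 'm \<Rightarrow> 'k ^ 'l.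
        Vector_Spaces.linear (*s) (*s) f \<and> surj f \<and> {v. f v = 0} = line_of p \<and>
        (\<forall>A. A \<noteq> p \<longrightarrow> line_of (ell A) = f ` line_of A))"

definition fibre_line ::
    "(('k::field, 'm::finite) proj \<Rightarrow> ('k, 'l::finite) proj) \<Rightarrow> ('k, 'm) proj \<Rightarrow> ('k, 'l) proj
      \<Rightarrow> ('k, 'm) proj set" where
  "fibre_line ell p P = {p} \<union> {A. A \<noteq> p \<and> ell A = P}"

end

theory Submission
  imports Defs
begin

text \<open>
  A linear map commutes with taking spans. So for a set \<open>S\<close> of points avoiding the centre \<open>p\<close>, the
  span of the projected points is the projection of the span of \<open>S\<close>
  (\<open>proj_span_image_linear_projection\<close>). Hence points of \<open>X\<close>, the image of \<open>C\<close>, whose span contains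
  \<open>P\<close> can be lifted one by one to points of \<open>C\<close> whose span meets the fibre of \<open>P\<close> outside \<open>p\<close>, and
  conversely points of \<open>C\<close> spanning some point of that fibre are projected to points of \<open>X\<close>
  spanning \<open>P\<close>. Neither passage increases the number of points, so the \<open>X\<close>-rank of \<open>P\<close> is the least
  \<open>C\<close>-rank on the fibre. This argument applies to any non-degenerate set of points in place of \<open>C\<close>
  (\<open>proj_rank_linear_projection\<close>).

  Non-degeneracy guarantees that every rank is attained, and bounds all of them by the number of
  homogeneous coordinates, so that the minimum is over a finite set. For a rational normal curve it
  is the Vandermonde argument: restricted to the standard curve, a nonzero linear form is a nonzero
  polynomial of degree at most that of the curve, which cannot vanish identically (\<open>span_veronese_vec\<close>).
\<close>

section \<open>Points, spans and ranks\<close>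

lemma line_of_eq_span_singleton:
  fixes A :: "('k::field, 'm::finite) proj"
  obtains v where "v \<noteq> 0" "line_of A = vec.span {v}"
proof -
  have sub: "vec.subspace (line_of A)" and dim: "vec.dim (line_of A) = 1"
    using line_of[of A] by auto
  obtain B where B: "B \<subseteq> line_of A" "vec.independent B" "line_of A \<subseteq> vec.span B"
    "card B = vec.dim (line_of A)"
    using vec.basis_exists[of "line_of A"] by blast
  then obtain v where v: "B = {v}"
    using dim by (auto simp: card_1_singleton_iff)
  have "line_of A = vec.span {v}"
    using B v vec.span_minimal[OF _ sub] by blast
  moreover have "v \<noteq> 0"
    using B(2) v vec.dependent_zero by blast
  ultimately show thesis
    by (rule that[rotated])
qed

lemma proj_rank_le_card:
  assumes "S \<subseteq> Y" "finite S" "Q \<in> proj_span S"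
  shows "proj_rank Y Q \<le> card S"
  unfolding proj_rank_def by (rule Least_le) (use assms in blast)

text \<open>
  A basis of the ambient space can be chosen among the vectors lying on the lines of \<open>Y\<close>; the points
  of \<open>Y\<close> carrying its members span everything.
\<close>

lemma nondegenerate_finite_spanning_subset:
  fixes Y :: "('k::field, 'm::finite) proj set"
  assumes "vec.span (\<Union>A\<in>Y. line_of A) = UNIV"
  obtains S where "S \<subseteq> Y" "finite S" "card S \<le> CARD('m)" "proj_span S = UNIV"
proof -
  obtain B where B: "B \<subseteq> (\<Union>A\<in>Y. line_of A)" "vec.independent B"
      "(\<Union>A\<in>Y. line_of A) \<subseteq> vec.span B"
    using vec.maximal_independent_subset by blast
  have fin: "finite B"
    using B(2) by (rule vec.finiteI_independent)
  have "card B \<le> vec.dim (UNIV :: ('k ^ 'm) set)"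
    using B(2) by (intro vec.independent_card_le_dim) auto
  then have card_B: "card B \<le> CARD('m)"
    by (simp add: vec.dim_UNIV card_cart_basis vec.dimension_def)
  obtain h where h: "\<And>b. b \<in> B \<Longrightarrow> h b \<in> Y \<and> b \<in> line_of (h b)"
    using B(1) by (metis UN_E subsetD)
  have "UNIV \<subseteq> vec.span B"
    using assms vec.span_minimal[OF B(3) vec.subspace_span] by simp
  also have "\<dots> \<subseteq> vec.span (\<Union>A\<in>h ` B. line_of A)"
    by (rule vec.span_mono) (use h in blast)
  finally have "proj_span (h ` B) = UNIV"
    unfolding proj_span_def by blast
  moreover have "card (h ` B) \<le> CARD('m)"
    using card_image_le[OF fin, of h] card_B by linarith
  ultimately show thesis
    using that[of "h ` B"] h fin by blast
qed

lemma proj_rank_le_CARD: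
  fixes Y :: "('k::field, 'm::finite) proj set"
  assumes "vec.span (\<Union>A\<in>Y. line_of A) = UNIV"
  shows "proj_rank Y Q \<le> CARD('m)"
  using nondegenerate_finite_spanning_subset[OF assms] proj_rank_le_card
  by (metis UNIV_I le_trans)

lemma proj_rank_attained:
  fixes Y :: "('k::field, 'm::finite) proj set"
  assumes "vec.span (\<Union>A\<in>Y. line_of A) = UNIV"
  obtains S where "S \<subseteq> Y" "finite S" "card S = proj_rank Y Q" "Q \<in> proj_span S"
proof -
  have "\<exists>k. \<exists>S\<subseteq>Y. finite S \<and> card S = k \<and> Q \<in> proj_span S"
    using nondegenerate_finite_spanning_subset[OF assms] by (metis UNIV_I)
  from LeastI_ex[OF this] show thesis
    unfolding proj_rank_def[symmetric] using that by blast
qed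

section \<open>Linear projections\<close>

lemma span_lines_linear_image:
  assumes lin: "Vector_Spaces.linear (*s) (*s) (f :: 'k::field ^ 'm::finite \<Rightarrow> 'k ^ 'l::finite)"
    and ell: "\<And>A. A \<in> S \<Longrightarrow> line_of (ell A) = f ` line_of A"
  shows "vec.span (\<Union>B\<in>ell ` S. line_of B) = f ` vec.span (\<Union>A\<in>S. line_of A)"
proof -
  have "(\<Union>B\<in>ell ` S. line_of B) = f ` (\<Union>A\<in>S. line_of A)"
    using ell by (simp add: image_UN)
  then show ?thesis
    using vec.linear_span_image[OF lin] by simp
qed

text \<open>
  Every point in the span of the projected points comes from a point of the span other than the
  centre: a vector on its line has a preimage in the linear span of \<open>S\<close>, and this preimage lies
  outside the kernel.
\<close>

lemma proj_span_image_linear_projection: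
  fixes ell :: "('k::field, 'm::finite) proj \<Rightarrow> ('k, 'l::finite) proj"
  assumes proj: "linear_projection_from p ell" and "p \<notin> S"
  shows "proj_span (ell ` S) = ell ` (proj_span S - {p})"
proof -
  obtain f :: "'k ^ 'm \<Rightarrow> 'k ^ 'l" where lin: "Vector_Spaces.linear (*s) (*s) f"
    and ker: "{v. f v = 0} = line_of p"
    and ell: "\<And>A. A \<noteq> p \<Longrightarrow> line_of (ell A) = f ` line_of A"
    using proj unfolding linear_projection_from_def by blast
  have span: "vec.span (\<Union>B\<in>ell ` S. line_of B) = f ` vec.span (\<Union>A\<in>S. line_of A)"
    using \<open>p \<notin> S\<close> by (intro span_lines_linear_image[OF lin] ell) blast
  show ?thesis
  proof (intro equalityI subsetI)
    fix P assume "P \<in> ell ` (proj_span S - {p})"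
    then obtain A where "A \<noteq> p" "P = ell A" "line_of A \<subseteq> vec.span (\<Union>A\<in>S. line_of A)"
      unfolding proj_span_def by blast
    then show "P \<in> proj_span (ell ` S)"
      unfolding proj_span_def span using ell by (simp add: image_mono)
  next
    fix P assume P: "P \<in> proj_span (ell ` S)"
    obtain v where v: "v \<noteq> 0" "line_of P = vec.span {v}"
      by (rule line_of_eq_span_singleton)
    have "v \<in> f ` vec.span (\<Union>A\<in>S. line_of A)"
      using P v(2) vec.span_base[of v "{v}"] unfolding proj_span_def span by blast
    then obtain w where w: "w \<in> vec.span (\<Union>A\<in>S. line_of A)" "f w = v"
      by blast
    have "w \<noteq> 0"
      using v(1) w(2) vec.linear_0[OF lin] by blast
    then have line: "line_of (proj_point w) = vec.span {w}"
      by (rule line_of_proj_point)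
    have neq: "proj_point w \<noteq> p"
      using ker v(1) w(2) line vec.span_base[of w "{w}"] by blast
    have "line_of (ell (proj_point w)) = line_of P"
      using ell[OF neq] line v(2) w(2) vec.linear_span_image[OF lin, of "{w}"] by simp
    then have "ell (proj_point w) = P"
      by (simp add: line_of_inject)
    moreover have "proj_point w \<in> proj_span S"
      using line w(1) vec.span_minimal[of "{w}"] vec.subspace_span
      unfolding proj_span_def by blast
    ultimately show "P \<in> ell ` (proj_span S - {p})"
      using neq by blast
  qed
qed

lemma nondegenerate_linear_projection:
  fixes ell :: "('k::field, 'm::finite) proj \<Rightarrow> ('k, 'l::finite) proj"
  assumes proj: "linear_projection_from p ell" and "p \<notin> Y"
    and "vec.span (\<Union>A\<in>Y. line_of A) = UNIV"
  shows "vec.span (\<Union>B\<in>ell ` Y. line_of B) = UNIV"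
proof -
  obtain f :: "'k ^ 'm \<Rightarrow> 'k ^ 'l" where lin: "Vector_Spaces.linear (*s) (*s) f"
    and surj: "surj f" and ell: "\<And>A. A \<noteq> p \<Longrightarrow> line_of (ell A) = f ` line_of A"
    using proj unfolding linear_projection_from_def by blast
  have "vec.span (\<Union>B\<in>ell ` Y. line_of B) = f ` vec.span (\<Union>A\<in>Y. line_of A)"
    using \<open>p \<notin> Y\<close> by (intro span_lines_linear_image[OF lin] ell) blast
  then show ?thesis
    using assms(3) surj by simp
qed

text \<open>
  Rank-computing sets of points can be moved both ways along the projection: the lift of a set
  spanning \<open>P\<close> spans some point over \<open>P\<close>, and the image of a set spanning a point over \<open>P\<close> spans
  \<open>P\<close>.
\<close>

theorem proj_rank_linear_projection:
  fixes ell :: "('k::field, 'm::finite) proj \<Rightarrow> ('k, 'l::finite) proj"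
  assumes proj: "linear_projection_from p ell" and "p \<notin> Y"
    and nondeg: "vec.span (\<Union>A\<in>Y. line_of A) = UNIV"
  shows "proj_rank (ell ` Y) P = Min (proj_rank Y ` (fibre_line ell p P - {p}))"
proof -
  have fibre: "fibre_line ell p P - {p} = {A. A \<noteq> p \<and> ell A = P}"
    unfolding fibre_line_def by blast
  have lower: "proj_rank (ell ` Y) P \<le> proj_rank Y A" if A: "A \<noteq> p" "ell A = P" for A
  proof -
    obtain S where S: "S \<subseteq> Y" "finite S" "card S = proj_rank Y A" "A \<in> proj_span S"
      using proj_rank_attained[OF nondeg] by blast
    have "P \<in> proj_span (ell ` S)"
      using proj_span_image_linear_projection[OF proj, of S] S A \<open>p \<notin> Y\<close> by blast
    then have "proj_rank (ell ` Y) P \<le> card (ell ` S)"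
      using S by (intro proj_rank_le_card) auto
    also have "\<dots> \<le> proj_rank Y A"
      using card_image_le[OF S(2)] S(3) by metis
    finally show ?thesis .
  qed
  obtain T where T: "T \<subseteq> ell ` Y" "finite T" "card T = proj_rank (ell ` Y) P" "P \<in> proj_span T"
    using proj_rank_attained[OF nondegenerate_linear_projection[OF assms]] by blast
  \<comment> \<open>One preimage for each point of \<open>T\<close>, so that the lift is no larger than \<open>T\<close>.\<close>
  then obtain S where S: "S \<subseteq> Y" "finite S" "T = ell ` S" "card S = card T"
    by (metis subset_image_inj card_image finite_image_iff)
  then have "p \<notin> S"
    using \<open>p \<notin> Y\<close> by blast
  then have "P \<in> ell ` (proj_span S - {p})"
    using T(4) S(3) proj_span_image_linear_projection[OF proj] by simp
  then obtain A where A: "A \<in> proj_span S" "A \<noteq> p" "ell A = P"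
    by blast
  have "proj_rank Y A \<le> proj_rank (ell ` Y) P"
    using proj_rank_le_card[OF S(1,2) A(1)] S(4) T(3) by simp
  with lower[OF A(2,3)] have attained: "proj_rank (ell ` Y) P = proj_rank Y A"
    by simp
  have "finite (proj_rank Y ` {A. A \<noteq> p \<and> ell A = P})"
    by (rule finite_subset[of _ "{..CARD('m)}"]) (use proj_rank_le_CARD[OF nondeg] in auto)
  then have "Min (proj_rank Y ` {A. A \<noteq> p \<and> ell A = P}) = proj_rank (ell ` Y) P"
    by (rule Min_eqI) (use lower attained A in auto)
  then show ?thesis
    using fibre by simp
qed

section \<open>Rational normal curves\<close>

text \<open>
  The affine points \<open>(1, t)\<close> suffice: as many distinct parameters as there are coordinates give the
  rows of a Vandermonde matrix. A vector in its kernel is the coefficient vector of a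
  polynomial whose degree is smaller than its number of roots, so it vanishes.
\<close>

lemma span_veronese_vec:
  fixes idx :: "'m::finite \<Rightarrow> nat"
  assumes idx: "bij_betw idx UNIV {..<CARD('m)}"
  shows "vec.span {veronese_vec idx x | x :: 'k::field_char_0 ^ 2. x \<noteq> 0} = UNIV"
proof -
  define t :: "'m \<Rightarrow> 'k" where "t i = of_nat (idx i)" for i
  define pt :: "'m \<Rightarrow> 'k ^ 2" where "pt i = vector [1, t i]" for i
  define V :: "'k ^ 'm ^ 'm" where "V = (\<chi> i. veronese_vec idx (pt i))"
  have inj_idx: "inj idx" and idx_less: "idx i < CARD('m)" for i
    using idx by (auto simp: bij_betw_def)
  have inj_t: "inj t"
    using inj_idx unfolding t_def inj_def by simp
  have pt: "pt i $ 1 = 1" "pt i $ 2 = t i" "pt i \<noteq> 0" for i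
  proof -
    show 1: "pt i $ 1 = 1" and "pt i $ 2 = t i"
      by (simp_all add: pt_def vector_2)
    show "pt i \<noteq> 0"
      using 1 by (metis zero_index zero_neq_one)
  qed
  have "c = 0" if c: "V *v c = 0" for c
  proof (rule ccontr)
    assume "c \<noteq> 0"
    define q where "q = (\<Sum>j\<in>UNIV. monom (c $ j) (idx j))"
    have coeff_q: "coeff q (idx j) = c $ j" for j
    proof -
      have "coeff q (idx j) = (\<Sum>i\<in>UNIV. if i = j then c $ i else 0)"
        unfolding q_def coeff_sum using inj_idx by (intro sum.cong) (auto simp: inj_eq)
      then show ?thesis
        by simp
    qed
    have "q \<noteq> 0"
      using \<open>c \<noteq> 0\<close> coeff_q by (metis coeff_0 vec_eq_iff zero_index)
    have "poly q (t i) = (V *v c) $ i" for i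
      by (simp add: q_def poly_sum poly_monom V_def matrix_vector_mult_def veronese_vec_def pt
          mult.commute)
    then have "range t \<subseteq> {z. poly q z = 0}"
      using c by auto
    then have "CARD('m) \<le> card {z. poly q z = 0}"
      using card_mono[OF poly_roots_finite[OF \<open>q \<noteq> 0\<close>]] card_image[OF inj_t] by metis
    also have "\<dots> \<le> degree q"
      using \<open>q \<noteq> 0\<close> by (rule card_poly_roots_bound)
    also have "\<dots> \<le> CARD('m) - 1"
      unfolding q_def
    proof (rule degree_sum_le)
      fix j :: 'm
      have "degree (monom (c $ j) (idx j)) \<le> idx j"
        by (rule degree_monom_le)
      then show "degree (monom (c $ j) (idx j)) \<le> CARD('m) - 1"
        using idx_less[of j] by linarith
    qed simp
    finally show False
      using zero_less_card_finite[where 'a = 'm] by linarith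
  qed
  then have "vec.span (rows V) = UNIV"
    using matrix_left_invertible_ker[of V] matrix_left_invertible_span_rows_gen[of V] by blast
  moreover have "rows V \<subseteq> {veronese_vec idx x | x :: 'k ^ 2. x \<noteq> 0}"
    using pt(3) by (auto simp: rows_def row_def V_def)
  ultimately show ?thesis
    using vec.span_mono by blast
qed

lemma rational_normal_curve_nondegenerate:
  fixes C :: "('k::field_char_0, 'm::finite) proj set"
  assumes "rational_normal_curve C"
  shows "vec.span (\<Union>A\<in>C. line_of A) = UNIV"
proof -
  obtain idx :: "'m \<Rightarrow> nat" and M :: "'k ^ 'm ^ 'm"
    where idx: "bij_betw idx UNIV {..<CARD('m)}" and M: "invertible M"
      and C: "C = {proj_point (M *v veronese_vec idx x) | x. x \<noteq> 0}"
    using assms unfolding rational_normal_curve_def by blast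
  let ?V = "{veronese_vec idx x | x :: 'k ^ 2. x \<noteq> 0}"
  have "(*v) M ` ?V \<subseteq> vec.span (\<Union>A\<in>C. line_of A)"
  proof clarify
    fix x :: "'k ^ 2" assume x: "x \<noteq> 0"
    let ?w = "M *v veronese_vec idx x"
    show "?w \<in> vec.span (\<Union>A\<in>C. line_of A)"
    proof (cases "?w = 0")
      case True
      then show ?thesis
        by (simp add: vec.span_zero)
    next
      case False
      then have "?w \<in> line_of (proj_point ?w)"
        by (simp add: line_of_proj_point vec.span_base)
      then show ?thesis
        using C x by (intro vec.span_base) blast
    qed
  qed
  then have "vec.span ((*v) M ` ?V) \<subseteq> vec.span (\<Union>A\<in>C. line_of A)"
    by (rule vec.span_minimal) (rule vec.subspace_span)
  moreover have "vec.span ((*v) M ` ?V) = range ((*v) M)"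
    using vec.linear_span_image[OF matrix_vector_mul_linear_gen[of M], of ?V]
      span_veronese_vec[OF idx, where 'k = 'k] by simp
  moreover have "surj ((*v) M)"
    using M matrix_right_invertible_surjective[of M] unfolding invertible_def by blast
  ultimately show ?thesis
    by blast
qed

section \<open>Projections of rational normal curves\<close>

theorem lemma2:
  fixes n :: nat
    and C :: "('k::{alg_closed_field, field_char_0}, 'm::finite) proj set"
    and p :: "('k, 'm) proj"
    and ell :: "('k, 'm) proj \<Rightarrow> ('k, 'l::finite) proj"
    and X :: "('k, 'l) proj set"
    and P :: "('k, 'l) proj"
  assumes "CARD('m) = n + 2" and "CARD('l) = n + 1"
    and "rational_normal_curve C"
    and "p \<notin> C"
    and "linear_projection_from p ell"
    and "X = ell ` C"
    and "proj_rank X P \<le> proj_rank C p - 1"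
  shows "proj_rank X P = Min (proj_rank C ` (fibre_line ell p P - {p}))"
  using proj_rank_linear_projection rational_normal_curve_nondegenerate assms(3-6) by blast

end
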